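(* Let $n\ge 1$. Then $(GL_n(\mathbb{R}), g)$, where $g_A(V,W)=\mathrm{tr}(A^{-1}VA^{-1}W)$ for $A\in GL_n(\mathbb{R})$ and $V,W\in T_A(GL_n(\mathbb{R}))=M_n(\mathbb{R})$, is a homogeneous Semi-Riemannian manifold with signature $\left(\frac{n(n+1)}{2},\frac{n(n-1)}{2}\right)$.
   Context: $M_n(\mathbb{R})$ is the vector space of real $n\times n$ matrices and $GL_n(\mathbb{R})\subset M_n(\mathbb{R})$ is the open subset of nonsingular matrices, so every tangent space of $GL_n(\mathbb{R})$ is identified with $M_n(\mathbb{R})$. A Semi-Riemannian manifold is a smooth real manifold with a symmetric nondegenerate $(0,2)$ tensor field $g$ of constant signature. The signature $(p,q)$ lists first the index of positivity $p$ and then the index of negativity $q$. The manifold $(M,g)$ is homogeneous if for all $p_1,p_2\in M$ there is a diffeomorphism $F:M\to M$ preserving $g$ with $F(p_1)=p_2$. *)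

theory Defs
  imports "HOL-Analysis.Analysis"
begin

(* The manifolds considered here are open subsets of a Euclidean space with the smooth
   structure given by the identity chart.  All tangent spaces are then identified with the
   ambient space, so a (0,2) tensor field is a function g, where g x v w is the value at
   the point x on the tangent vectors v and w. *)

text \<open>k-fold continuous differentiability; only meaningful on an open set, since
  \<^const>\<open>frechet_derivative\<close> is taken with respect to full neighbourhoods.\<close>

primrec k_smooth_on ::
  "nat \<Rightarrow> 'a::euclidean_space set \<Rightarrow> ('a \<Rightarrow> 'b::euclidean_space) \<Rightarrow> bool" where
  "k_smooth_on 0 U f \<longleftrightarrow> continuous_on U f"
| "k_smooth_on (Suc k) U f \<longleftrightarrow>
     (\<forall>x\<in>U. f differentiable (at x)) \<and>
     (\<forall>v. k_smooth_on k U (\<lambda>x. frechet_derivative f (at x) v))"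

definition smooth_on ::
  "'a::euclidean_space set \<Rightarrow> ('a \<Rightarrow> 'b::euclidean_space) \<Rightarrow> bool" where
  "smooth_on U f \<longleftrightarrow> (\<forall>k. k_smooth_on k U f)"

definition diffeomorphism_on :: "'a::euclidean_space set \<Rightarrow> ('a \<Rightarrow> 'a) \<Rightarrow> bool" where
  "diffeomorphism_on U F \<longleftrightarrow>
     bij_betw F U U \<and> smooth_on U F \<and> smooth_on U (inv_into U F)"

definition symmetric_form :: "('a \<Rightarrow> 'a \<Rightarrow> real) \<Rightarrow> bool" where
  "symmetric_form b \<longleftrightarrow> (\<forall>v w. b v w = b w v)"

definition nondegenerate_form :: "('a::euclidean_space \<Rightarrow> 'a \<Rightarrow> real) \<Rightarrow> bool" where
  "nondegenerate_form b \<longleftrightarrow> (\<forall>v. (\<forall>w. b v w = 0) \<longrightarrow> v = 0)"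

text \<open>The index of positivity (negativity) is the largest dimension of a subspace on which
  the form is positive (negative) definite.\<close>

definition positive_index :: "('a::euclidean_space \<Rightarrow> 'a \<Rightarrow> real) \<Rightarrow> nat" where
  "positive_index b = Max {dim S | S. subspace S \<and> (\<forall>v\<in>S - {0}. b v v > 0)}"

definition negative_index :: "('a::euclidean_space \<Rightarrow> 'a \<Rightarrow> real) \<Rightarrow> nat" where
  "negative_index b = Max {dim S | S. subspace S \<and> (\<forall>v\<in>S - {0}. b v v < 0)}"

definition signature :: "('a::euclidean_space \<Rightarrow> 'a \<Rightarrow> real) \<Rightarrow> nat \<times> nat" where
  "signature b = (positive_index b, negative_index b)"

definition smooth_tensor_field_on ::
  "'a::euclidean_space set \<Rightarrow> ('a \<Rightarrow> 'a \<Rightarrow> 'a \<Rightarrow> real) \<Rightarrow> bool" where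
  "smooth_tensor_field_on U g \<longleftrightarrow>
     (\<forall>x\<in>U. bilinear (g x)) \<and> (\<forall>v w. smooth_on U (\<lambda>x. g x v w))"

definition semi_riemannian_manifold ::
  "'a::euclidean_space set \<Rightarrow> ('a \<Rightarrow> 'a \<Rightarrow> 'a \<Rightarrow> real) \<Rightarrow> bool" where
  "semi_riemannian_manifold U g \<longleftrightarrow>
     open U \<and> smooth_tensor_field_on U g \<and>
     (\<forall>x\<in>U. symmetric_form (g x) \<and> nondegenerate_form (g x)) \<and>
     (\<exists>s. \<forall>x\<in>U. signature (g x) = s)"

definition preserves_metric_on ::
  "'a::euclidean_space set \<Rightarrow> ('a \<Rightarrow> 'a \<Rightarrow> 'a \<Rightarrow> real) \<Rightarrow> ('a \<Rightarrow> 'a) \<Rightarrow> bool" where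
  "preserves_metric_on U g F \<longleftrightarrow>
     (\<forall>x\<in>U. \<forall>v w. g (F x) (frechet_derivative F (at x) v) (frechet_derivative F (at x) w)
        = g x v w)"

definition homogeneous ::
  "'a::euclidean_space set \<Rightarrow> ('a \<Rightarrow> 'a \<Rightarrow> 'a \<Rightarrow> real) \<Rightarrow> bool" where
  "homogeneous U g \<longleftrightarrow>
     (\<forall>x\<in>U. \<forall>y\<in>U. \<exists>F. diffeomorphism_on U F \<and> preserves_metric_on U g F \<and> F x = y)"

definition general_linear :: "(real^'n^'n) set" where
  "general_linear = {A. invertible A}"

definition trace_metric :: "real^'n^'n \<Rightarrow> real^'n^'n \<Rightarrow> real^'n^'n \<Rightarrow> real" where
  "trace_metric A V W = trace (matrix_inv A ** V ** matrix_inv A ** W)"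

end

(* Left multiplication by any C in GL_n is a diffeomorphism preserving g, which gives homogeneity.
   Writing tangent vectors at A as A X turns g_A into the form tr(X Y), which equals |X|^2 on
   symmetric X = Y and -|X|^2 on skew X = Y.  These two subspaces are complementary, so their
   dimensions are the indices.  Smoothness of g reduces to that of matrix inversion, obtained by
   induction from D(inv)_A(V) = - A^-1 V A^-1 and the product rule. *)

theory Submission
  imports Defs
begin

section \<open>Calculus of k-fold smooth functions on open sets\<close>

text \<open>On an open set, agreement on \<open>U\<close> is agreement near each point of
  \<open>U\<close>, so the derivatives agree there too and the induction can pass to them.\<close>

lemma k_smooth_on_cong:
  assumes "open U" "\<And>x. x \<in> U \<Longrightarrow> f x = g x" "k_smooth_on k U f"
  shows "k_smooth_on k U g"
  using assms(2,3)
proof (induction k arbitrary: f g)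
  case 0
  then show ?case using continuous_on_cong by force
next
  case (Suc k)
  have D: "(g has_derivative frechet_derivative f (at x)) (at x)" if "x \<in> U" for x
    using Suc.prems that \<open>open U\<close>
    by (auto intro!: has_derivative_transform_within_open[of f _ x UNIV U g]
        simp: frechet_derivative_works)
  have "k_smooth_on k U (\<lambda>x. frechet_derivative g (at x) v)" for v
  proof (rule Suc.IH)
    show "k_smooth_on k U (\<lambda>x. frechet_derivative f (at x) v)"
      using Suc.prems(2) by simp
  qed (use frechet_derivative_at[OF D] in auto)
  with D show ?case
    unfolding k_smooth_on.simps differentiable_def by blast
qed

text \<open>Derivatives are unique, so an explicit formula \<open>f'\<close> may replace
  \<open>frechet_derivative\<close>. This is the introduction rule behind the inductive smoothness
  proofs below.\<close>

lemma k_smooth_on_SucI: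
  assumes "open U" and D: "\<And>x. x \<in> U \<Longrightarrow> (f has_derivative f' x) (at x)"
    and "\<And>v. k_smooth_on k U (\<lambda>x. f' x v)"
  shows "k_smooth_on (Suc k) U f"
proof -
  have "k_smooth_on k U (\<lambda>x. frechet_derivative f (at x) v)" for v
    by (rule k_smooth_on_cong[OF \<open>open U\<close> _ assms(3)[of v]])
      (simp add: frechet_derivative_at[OF D, symmetric])
  with D show ?thesis
    unfolding k_smooth_on.simps differentiable_def by blast
qed

lemma k_smooth_on_Suc_derivative:
  assumes "k_smooth_on (Suc k) U f" "x \<in> U"
  shows "(f has_derivative frechet_derivative f (at x)) (at x)"
  using assms by (simp add: frechet_derivative_works)

text \<open>The recursive definition does not list the lower orders. They come from "differentiable
  implies continuous" at the bottom of the induction.\<close>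

lemma k_smooth_on_Suc_imp:
  assumes "k_smooth_on (Suc k) U f"
  shows "k_smooth_on k U f"
  using assms
proof (induction k arbitrary: f)
  case 0
  then show ?case
    by (simp add: continuous_at_imp_continuous_on differentiable_imp_continuous_within)
next
  case (Suc k)
  from Suc.prems Suc.IH show ?case unfolding k_smooth_on.simps(2) by blast
qed

lemma k_smooth_on_const: "open U \<Longrightarrow> k_smooth_on k U (\<lambda>x. c)"
proof (induction k arbitrary: c)
  case (Suc k)
  then show ?case by (intro k_smooth_on_SucI[where f' = "\<lambda>x v. 0"]) auto
qed auto

lemma k_smooth_on_linear:
  assumes "open U" "linear f"
  shows "k_smooth_on k U f"
proof (cases k)
  case 0
  then show ?thesis using assms linear_continuous_on linear_conv_bounded_linear by auto
next
  case (Suc m)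
  with assms show ?thesis
    by (auto intro!: k_smooth_on_SucI[where f' = "\<lambda>x. f"] k_smooth_on_const
        linear_imp_has_derivative simp del: k_smooth_on.simps)
qed

lemma k_smooth_on_add:
  assumes "open U" "k_smooth_on k U f" "k_smooth_on k U g"
  shows "k_smooth_on k U (\<lambda>x. f x + g x)"
  using assms(2,3)
proof (induction k arbitrary: f g)
  case 0
  then show ?case by (auto intro: continuous_intros)
next
  case (Suc k)
  have "((\<lambda>x. f x + g x) has_derivative
      (\<lambda>v. frechet_derivative f (at x) v + frechet_derivative g (at x) v)) (at x)"
    if "x \<in> U" for x
    using Suc.prems that by (intro has_derivative_add k_smooth_on_Suc_derivative)
  then show ?case
    by (rule k_smooth_on_SucI[OF \<open>open U\<close>]) (use Suc in auto)
qed

text \<open>By the Leibniz rule the derivative is a sum of two terms of the same shape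
  \<open>h (f x) (g x)\<close>, so the induction runs over all pairs of functions at once.\<close>

lemma k_smooth_on_bilinear:
  assumes "open U" "bounded_bilinear h" "k_smooth_on k U f" "k_smooth_on k U g"
  shows "k_smooth_on k U (\<lambda>x. h (f x) (g x))"
  using assms(3,4)
proof (induction k arbitrary: f g)
  case 0
  then show ?case using bounded_bilinear.continuous_on[OF assms(2)] by auto
next
  case (Suc k)
  have "((\<lambda>x. h (f x) (g x)) has_derivative
      (\<lambda>v. h (f x) (frechet_derivative g (at x) v) + h (frechet_derivative f (at x) v) (g x))) (at x)"
    if "x \<in> U" for x
    using Suc.prems that by (intro bounded_bilinear.FDERIV[OF assms(2)] k_smooth_on_Suc_derivative)
  then show ?case
  proof (rule k_smooth_on_SucI[OF \<open>open U\<close>])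
    show "k_smooth_on k U (\<lambda>x. h (f x) (frechet_derivative g (at x) v)
        + h (frechet_derivative f (at x) v) (g x))" for v
      \<comment> \<open>Each term pairs a derivative, already of order \<open>k\<close>, with an
        undifferentiated factor whose order must first be lowered to \<open>k\<close>.\<close>
      using Suc.prems Suc.prems[THEN k_smooth_on_Suc_imp]
      by (intro k_smooth_on_add Suc.IH \<open>open U\<close>) auto
  qed
qed

section \<open>The general linear group and smoothness of matrix inversion\<close>

lemma matrix_inv_mult:
  assumes "A \<in> general_linear"
  shows "A ** matrix_inv A = mat 1" "matrix_inv A ** A = mat 1"
proof -
  have "A ** matrix_inv A = mat 1 \<and> matrix_inv A ** A = mat 1"
    using assms unfolding general_linear_def invertible_def matrix_inv_def mem_Collect_eq
    by (rule someI_ex)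
  then show "A ** matrix_inv A = mat 1" "matrix_inv A ** A = mat 1" by auto
qed

lemma matrix_inv_cancel:
  assumes "A \<in> general_linear"
  shows "A ** (matrix_inv A ** X) = X" "matrix_inv A ** (A ** X) = X"
    "X ** A ** matrix_inv A = X" "X ** matrix_inv A ** A = X"
  using matrix_inv_mult[OF assms] by (metis matrix_mul_assoc matrix_mul_lid matrix_mul_rid)+

lemma general_linear_mult:
  "A \<in> general_linear \<Longrightarrow> B \<in> general_linear \<Longrightarrow> A ** B \<in> general_linear"
  by (simp add: general_linear_def invertible_mult)

lemma matrix_inv_general_linear: "A \<in> general_linear \<Longrightarrow> matrix_inv A \<in> general_linear"
  using matrix_inv_mult unfolding general_linear_def invertible_def by blast

lemma matrix_inv_unique:
  fixes A B :: "real^'n^'n"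
  assumes "A ** B = mat 1" "B ** A = mat 1"
  shows "matrix_inv A = B"
proof -
  have "A \<in> general_linear"
    using assms unfolding general_linear_def invertible_def by blast
  then show ?thesis by (metis assms(1) matrix_inv_cancel(2) matrix_mul_rid)
qed

lemma bounded_bilinear_matrix_mult:
  "bounded_bilinear ((**) :: real^'n^'m \<Rightarrow> real^'p^'n \<Rightarrow> real^'p^'m)"
  unfolding bilinear_conv_bounded_bilinear[symmetric] bilinear_def
  by (auto intro!: linearI simp: vec_eq_iff matrix_matrix_mult_def sum.distrib algebra_simps sum_distrib_left)

lemma linear_trace: "linear (trace :: real^'n^'n \<Rightarrow> real)"
  by (intro linearI) (simp_all add: trace_def sum.distrib sum_distrib_left)

lemma continuous_on_det:
  fixes f :: "'a::topological_space \<Rightarrow> real^'n^'n"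
  assumes "\<And>i j. continuous_on S (\<lambda>x. f x $ i $ j)"
  shows "continuous_on S (\<lambda>x. det (f x))"
  unfolding det_def by (intro continuous_intros assms)

lemma open_general_linear: "open (general_linear :: (real^'n^'n) set)"
proof -
  have "open ((\<lambda>A::real^'n^'n. det A) -` (- {0}))"
    by (intro open_vimage continuous_on_det continuous_intros)
  moreover have "general_linear = (\<lambda>A::real^'n^'n. det A) -` (- {0})"
    by (auto simp: general_linear_def invertible_det_nz)
  ultimately show ?thesis by simp
qed

text \<open>Cramer's rule makes each entry of the inverse a quotient of determinants, with a
  denominator that vanishes nowhere on \<open>general_linear\<close>.\<close>

lemma continuous_on_matrix_inv:
  "continuous_on general_linear (matrix_inv :: real^'n^'n \<Rightarrow> real^'n^'n)"
proof -
  have eq: "matrix_inv A $ i $ j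
      = det (\<chi> p q. if q = i then axis j 1 $ p else A $ p $ q) / det A"
    if "A \<in> general_linear" for A :: "real^'n^'n" and i j
  proof -
    \<comment> \<open>Column \<open>j\<close> of the inverse is the solution of the linear system
      with right-hand side \<open>axis j 1\<close>.\<close>
    have "A *v (matrix_inv A *v axis j 1) = axis j 1"
      using matrix_inv_mult[OF that] by (simp add: matrix_vector_mul_assoc)
    then have "matrix_inv A *v axis j 1
        = (\<chi> k. det (\<chi> p q. if q = k then axis j 1 $ p else A $ p $ q) / det A)"
      using that by (subst (asm) cramer) (auto simp: general_linear_def invertible_det_nz)
    then have "(matrix_inv A *v axis j 1) $ i
        = det (\<chi> p q. if q = i then axis j 1 $ p else A $ p $ q) / det A"
      by simp
    then show ?thesis by (simp add: matrix_vector_mult_basis column_def)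
  qed
  have nz: "det A \<noteq> 0" if "A \<in> general_linear" for A :: "real^'n^'n"
    using that by (simp add: general_linear_def invertible_det_nz)
  have "continuous_on general_linear (\<lambda>A::real^'n^'n. matrix_inv A $ i $ j)" for i j
  proof -
    have c: "continuous_on general_linear (\<lambda>A::real^'n^'n.
       (\<chi> p q. if q = i then axis j 1 $ p else A $ p $ q) $ p $ q)" for p q
      by (cases "q = i") (auto intro!: continuous_intros)
    have "continuous_on general_linear (\<lambda>A::real^'n^'n.
       det (\<chi> p q. if q = i then axis j 1 $ p else A $ p $ q) / det A)"
      using nz by (intro continuous_on_divide continuous_on_det c) (auto intro!: continuous_intros)
    then show ?thesis by (simp add: eq cong: continuous_on_cong)
  qed
  then have "continuous_on general_linear (\<lambda>A::real^'n^'n. \<chi> i j. matrix_inv A $ i $ j)"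
    by (intro continuous_on_vec_lambda)
  then show ?thesis by simp
qed

lemma has_derivative_matrix_inv:
  fixes A :: "real^'n^'n"
  assumes A: "A \<in> general_linear"
  shows "(matrix_inv has_derivative (\<lambda>V. - (matrix_inv A ** V ** matrix_inv A))) (at A)"
proof -
  interpret M: bounded_bilinear "(**) :: real^'n^'n \<Rightarrow> real^'n^'n \<Rightarrow> real^'n^'n"
    by (rule bounded_bilinear_matrix_mult)
  have lin: "bounded_linear (\<lambda>V. - (matrix_inv A ** V ** matrix_inv A))"
    by (intro bounded_linear_minus bounded_linear_compose[OF M.bounded_linear_left]
        M.bounded_linear_right)
  have lim: "(matrix_inv \<longlongrightarrow> matrix_inv A) (at A)"
    using A open_general_linear continuous_on_matrix_inv
    by (metis continuous_at continuous_on_eq_continuous_at)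
  obtain K where K: "0 \<le> K" "\<And>(X::real^'n^'n) (Y::real^'n^'n). norm (X ** Y) \<le> norm X * norm Y * K"
    using M.nonneg_bounded by metis
  define R where
    "R B = matrix_inv B - matrix_inv A - - (matrix_inv A ** (B - A) ** matrix_inv A)" for B
  \<comment> \<open>The remainder factors: \<open>B - A\<close> cancels against the denominator of
    the difference quotient, and the last factor tends to 0 by continuity of inversion.\<close>
  have R: "R B = matrix_inv A ** (B - A) ** (matrix_inv A - matrix_inv B)"
    if "B \<in> general_linear" for B
    using matrix_inv_mult[OF A] matrix_inv_cancel[OF A] matrix_inv_mult[OF that]
      matrix_inv_cancel[OF that]
    by (simp add: R_def M.diff_left M.diff_right)
  have bound: "norm (R B) / norm (B - A)
      \<le> norm (matrix_inv A) * K * K * norm (matrix_inv A - matrix_inv B)"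
    if "B \<in> general_linear" for B
  proof -
    have "norm (R B) \<le> norm (matrix_inv A) * norm (B - A) * K * norm (matrix_inv A - matrix_inv B) * K"
      unfolding R[OF that]
      by (intro order.trans[OF K(2)] mult_right_mono K(1) K(2)) auto
    \<comment> \<open>At \<open>B = A\<close> the quotient is 0, by the convention for division by
      zero.\<close>
    then show ?thesis by (cases "B = A") (auto simp: field_simps K(1))
  qed
  have "((\<lambda>B. norm (R B) / norm (B - A)) \<longlongrightarrow> 0) (at A)"
  proof (rule tendsto_sandwich)
    show "\<forall>\<^sub>F B in at A. 0 \<le> norm (R B) / norm (B - A)" by simp
    show "\<forall>\<^sub>F B in at A. norm (R B) / norm (B - A)
        \<le> norm (matrix_inv A) * K * K * norm (matrix_inv A - matrix_inv B)"
      using bound eventually_at_in_open'[OF open_general_linear A] by (auto elim: eventually_mono)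
    show "((\<lambda>B. norm (matrix_inv A) * K * K * norm (matrix_inv A - matrix_inv B)) \<longlongrightarrow> 0) (at A)"
      by (rule tendsto_eq_intros lim refl | simp)+
  qed simp
  with lin show ?thesis
    unfolding has_derivative_iff_norm R_def by simp
qed

text \<open>The derivative of inversion is a product of inverses and a constant, so order
  \<open>k\<close> for inversion yields order \<open>k\<close> for its derivative.\<close>

lemma k_smooth_on_matrix_inv:
  "k_smooth_on k general_linear (matrix_inv :: real^'n^'n \<Rightarrow> real^'n^'n)"
proof (induction k)
  case 0
  then show ?case by (simp add: continuous_on_matrix_inv)
next
  case (Suc k)
  show ?case
  proof (rule k_smooth_on_SucI[OF open_general_linear has_derivative_matrix_inv])
    fix V :: "real^'n^'n"
    note smooth = k_smooth_on_bilinear[OF open_general_linear bounded_bilinear_matrix_mult]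
      k_smooth_on_const[OF open_general_linear] Suc.IH
    \<comment> \<open>The sign is written as multiplication by \<open>- mat 1\<close>, so that the
      product rule covers it.\<close>
    have "k_smooth_on k general_linear
        (\<lambda>A. (- mat 1) ** (matrix_inv A ** V ** matrix_inv A))"
      by (intro smooth)
    then show "k_smooth_on k general_linear (\<lambda>A. - (matrix_inv A ** V ** matrix_inv A))"
      by (simp add: bounded_bilinear.minus_left[OF bounded_bilinear_matrix_mult])
  qed
qed

section \<open>The trace metric as a symmetric tensor field, and its homogeneity\<close>

lemma smooth_tensor_field_trace_metric:
  "smooth_tensor_field_on (general_linear :: (real^'n^'n) set) trace_metric"
proof -
  interpret M: bounded_bilinear "(**) :: real^'n^'n \<Rightarrow> real^'n^'n \<Rightarrow> real^'n^'n"
    by (rule bounded_bilinear_matrix_mult)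
  \<comment> \<open>This two-sided form specialises to every slot treated below, with
    \<open>mat 1\<close> as the missing factor.\<close>
  have lin: "linear (\<lambda>X::real^'n^'n. trace (P ** X ** Q))"
    for P Q :: "real^'n^'n"
    by (intro linearI) (simp_all add: M.add_right M.add_left M.scaleR_left M.scaleR_right
        linear_add[OF linear_trace] linear_cmul[OF linear_trace])
  have "bilinear (trace_metric A)" for A :: "real^'n^'n"
    unfolding bilinear_def trace_metric_def
    using lin[of "_ :: real^'n^'n" "mat 1"] lin[of "matrix_inv A" "matrix_inv A ** _"]
    by (simp add: matrix_mul_assoc)
  moreover have "smooth_on general_linear (\<lambda>A::real^'n^'n. trace_metric A V W)" for V W
  proof -
    \<comment> \<open>For fixed \<open>V\<close> and \<open>W\<close> the metric is this bilinear
      map with both arguments equal to \<open>matrix_inv A\<close>, so smoothness of inversion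
      suffices.\<close>
    have "bilinear (\<lambda>(X::real^'n^'n) (Y::real^'n^'n). trace (X ** V ** Y ** W))"
      unfolding bilinear_def
      using lin[of "_ :: real^'n^'n" W] lin[of "mat 1" "V ** _ ** W"]
      by (simp add: matrix_mul_assoc)
    then show ?thesis
      unfolding smooth_on_def trace_metric_def
      by (auto intro!: k_smooth_on_bilinear[where h = "\<lambda>X Y. trace (X ** V ** Y ** W)"]
          open_general_linear k_smooth_on_matrix_inv simp: bilinear_conv_bounded_bilinear)
  qed
  ultimately show ?thesis by (simp add: smooth_tensor_field_on_def)
qed

text \<open>Cyclicity of the trace exchanges the factors \<open>matrix_inv A ** V\<close> and
  \<open>matrix_inv A ** W\<close>.\<close>

lemma symmetric_trace_metric: "symmetric_form (trace_metric A)"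
  unfolding symmetric_form_def trace_metric_def
  by (metis matrix_mul_assoc trace_mul_sym)

lemma homogeneous_trace_metric:
  "homogeneous (general_linear :: (real^'n^'n) set) trace_metric"
  unfolding homogeneous_def
proof (intro ballI)
  fix A B :: "real^'n^'n"
  assume AB: "A \<in> general_linear" "B \<in> general_linear"
  let ?U = "general_linear :: (real^'n^'n) set"
  \<comment> \<open>The requirement \<open>C ** A = B\<close> forces this choice.\<close>
  define C where "C = B ** matrix_inv A"
  have C: "C \<in> ?U"
    using AB by (simp add: C_def general_linear_mult matrix_inv_general_linear)
  have lin: "linear ((**) X :: real^'n^'n \<Rightarrow> real^'n^'n)" for X :: "real^'n^'n"
    using bounded_bilinear_matrix_mult bilinear_conv_bounded_bilinear bilinear_def by blast
  have bij: "bij_betw ((**) C) ?U ?U"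
    by (rule bij_betw_byWitness[where f' = "(**) (matrix_inv C)"])
      (use C in \<open>auto simp: matrix_inv_cancel general_linear_mult matrix_inv_general_linear\<close>)
  \<comment> \<open>\<open>inv_into\<close> is controlled only on the image \<open>?U\<close>;
    agreement there with a linear map is enough to transfer smoothness.\<close>
  have "matrix_inv C ** X = inv_into ?U ((**) C) X" if "X \<in> ?U" for X
    using that C bij
    by (metis bij_betw_inv_into_left general_linear_mult matrix_inv_cancel(1) matrix_inv_general_linear)
  then have "smooth_on ?U (inv_into ?U ((**) C))"
    unfolding smooth_on_def
    using k_smooth_on_cong[OF open_general_linear _ k_smooth_on_linear[OF open_general_linear lin]]
    by blast
  then have "diffeomorphism_on ?U ((**) C)"
    unfolding diffeomorphism_on_def
    using bij k_smooth_on_linear[OF open_general_linear lin] by (simp add: smooth_on_def)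
  moreover have "preserves_metric_on ?U trace_metric ((**) C)"
    unfolding preserves_metric_on_def
  proof (intro ballI allI)
    fix X V W :: "real^'n^'n"
    assume X: "X \<in> ?U"
    \<comment> \<open>The derivative contributes a factor \<open>C\<close> to each tangent vector,
      which cancels the \<open>matrix_inv C\<close> produced here.\<close>
    have "matrix_inv (C ** X) = matrix_inv X ** matrix_inv C"
    proof (rule matrix_inv_unique)
      show "C ** X ** (matrix_inv X ** matrix_inv C) = mat 1"
        using X C by (simp add: matrix_mul_assoc matrix_inv_cancel matrix_inv_mult)
      show "matrix_inv X ** matrix_inv C ** (C ** X) = mat 1"
        using X C by (simp add: matrix_mul_assoc matrix_inv_cancel matrix_inv_mult)
    qed
    moreover have "frechet_derivative ((**) C) (at X) = (**) C"
      using frechet_derivative_at[OF linear_imp_has_derivative[OF lin]] by metis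
    ultimately show "trace_metric (C ** X) (frechet_derivative ((**) C) (at X) V)
        (frechet_derivative ((**) C) (at X) W) = trace_metric X V W"
      using C by (simp add: trace_metric_def matrix_mul_assoc matrix_inv_cancel)
  qed
  moreover have "C ** A = B" using AB by (simp add: C_def matrix_inv_cancel)
  ultimately show "\<exists>F. diffeomorphism_on ?U F \<and> preserves_metric_on ?U trace_metric F \<and> F A = B"
    by blast
qed

section \<open>Dimensions of the spaces of symmetric and skew matrices\<close>

definition symmetric_matrices :: "(real^'n^'n) set" where
  "symmetric_matrices = {X. transpose X = X}"

definition skew_matrices :: "(real^'n^'n) set" where
  "skew_matrices = {X. transpose X = - X}"

lemma transpose_add: "transpose (X + Y) = transpose X + transpose (Y :: 'a::plus^'n^'m)"
  by (simp add: transpose_def vec_eq_iff)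

lemma transpose_diff: "transpose (X - Y) = transpose X - transpose (Y :: 'a::minus^'n^'m)"
  by (simp add: transpose_def vec_eq_iff)

lemma subspace_symmetric_matrices: "subspace symmetric_matrices"
  by (auto simp: subspace_def symmetric_matrices_def transpose_add transpose_scalar)
     (simp add: transpose_def vec_eq_iff)

lemma subspace_skew_matrices: "subspace skew_matrices"
  by (auto simp: subspace_def skew_matrices_def transpose_add transpose_scalar)
     (simp add: transpose_def vec_eq_iff)

text \<open>Every matrix is the sum of its symmetric and skew parts, and only 0 is both, so the
  dimension formula for sums applies.\<close>

lemma dim_symmetric_plus_skew:
  "dim (symmetric_matrices :: (real^'n^'n) set) + dim (skew_matrices :: (real^'n^'n) set)
    = CARD('n) * CARD('n)"
proof -
  let ?S = "symmetric_matrices :: (real^'n^'n) set" and ?K = "skew_matrices :: (real^'n^'n) set"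
  have "X = 0" if "X \<in> ?S" "X \<in> ?K" for X
  proof -
    have "X = - X" using that by (simp add: symmetric_matrices_def skew_matrices_def)
    then show ?thesis by (simp add: vec_eq_iff)
  qed
  moreover have "0 \<in> ?S \<inter> ?K"
    by (simp add: subspace_0 subspace_symmetric_matrices subspace_skew_matrices)
  ultimately have "?S \<inter> ?K = {0}" by blast
  moreover have "X \<in> {Y + Z |Y Z. Y \<in> ?S \<and> Z \<in> ?K}" for X
  proof -
    let ?Y = "(1/2) *\<^sub>R (X + transpose X)" and ?Z = "(1/2) *\<^sub>R (X - transpose X)"
    have "?Y \<in> ?S" "?Z \<in> ?K"
      by (auto simp: symmetric_matrices_def skew_matrices_def transpose_scalar transpose_add
          transpose_diff algebra_simps)
    moreover have "X = ?Y + ?Z" by (simp add: vec_eq_iff field_simps)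
    ultimately show ?thesis by blast
  qed
  then have "{Y + Z |Y Z. Y \<in> ?S \<and> Z \<in> ?K} = UNIV" by blast
  moreover have "dim {Y + Z |Y Z. Y \<in> ?S \<and> Z \<in> ?K} + dim (?S \<inter> ?K) = dim ?S + dim ?K"
    by (rule dim_sums_Int[OF subspace_symmetric_matrices subspace_skew_matrices])
  ultimately show ?thesis by simp
qed

text \<open>The matrix units \<open>e (i, j)\<close> are the standard basis, so this is a coordinate
  subspace.\<close>

lemma dim_matrices_supported_on:
  "dim {X :: real^'m^'n. \<forall>i j. (i, j) \<notin> D \<longrightarrow> X $ i $ j = 0} = card D"
proof -
  define e :: "'n \<times> 'm \<Rightarrow> real^'m^'n" where "e = (\<lambda>(i, j). axis i (axis j 1))"
  have inj: "inj e"
    by (auto simp: inj_on_def e_def axis_eq_axis axis_eq_0_iff)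
  have Basis: "(Basis :: (real^'m^'n) set) = range e"
    by (auto simp: Basis_vec_def e_def)
  have inner: "X \<bullet> e (i, j) = X $ i $ j" for X i j
    by (simp add: e_def inner_axis)
  have "dim {X. \<forall>b\<in>Basis. b \<notin> e ` D \<longrightarrow> X \<bullet> b = 0} = card (e ` D)"
    by (rule dim_substandard) (auto simp: Basis)
  moreover have "card (e ` D) = card D" by (meson card_image inj inj_on_subset subset_UNIV)
  ultimately show ?thesis
    by (simp add: Basis inner inj_image_mem_iff[OF inj])
qed

text \<open>Swapping coordinates matches the pairs below the diagonal with those above, and the
  diagonal accounts for the rest. The injection \<open>r\<close> supplies an order on an index type
  that has none.\<close>

lemma card_strictly_ordered_pairs:
  fixes r :: "'n::finite \<Rightarrow> nat"
  assumes "inj r"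
  shows "2 * card {(i, j). r i < r j} = CARD('n) * (CARD('n) - 1)"
proof -
  let ?D = "{(i, j). r i < r j}" and ?E = "{(i, j). r j < r i}" and ?I = "range (\<lambda>i::'n. (i, i))"
  have UNIV: "?D \<union> ?E \<union> ?I = UNIV"
  proof -
    have "p \<in> ?D \<union> ?E \<union> ?I" for p
    proof (cases p)
      case (Pair i j)
      show ?thesis
      proof (cases "i = j")
        case False
        then have "r i \<noteq> r j" using injD[OF assms] by blast
        then show ?thesis using Pair by auto
      qed (use Pair in auto)
    qed
    then show ?thesis by blast
  qed
  have "bij_betw prod.swap ?D ?E"
    by (rule bij_betw_byWitness[where f' = prod.swap]) auto
  then have swap: "card ?E = card ?D" by (rule bij_betw_same_card[symmetric])
  have "CARD('n) * CARD('n) = card (?D \<union> ?E \<union> ?I)"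
    unfolding UNIV by (rule card_prod[symmetric])
  also have "\<dots> = card (?D \<union> ?E) + card ?I"
    by (rule card_Un_disjoint) auto
  also have "card (?D \<union> ?E) = card ?D + card ?E"
    by (rule card_Un_disjoint) auto
  also have "card ?I = CARD('n)" by (simp add: card_image inj_on_def)
  finally show ?thesis unfolding swap by (simp add: algebra_simps)
qed

text \<open>Antisymmetrisation maps the strictly upper triangular matrices, with indices ordered by
  \<open>to_nat\<close>, isomorphically onto the skew ones; it remains to count pairs.\<close>

lemma dim_skew_matrices:
  "2 * dim (skew_matrices :: (real^'n^'n) set) = CARD('n) * (CARD('n) - 1)"
proof -
  let ?D = "{(i, j). to_nat (i::'n) < to_nat (j::'n)}"
  let ?T = "{X :: real^'n^'n. \<forall>i j. (i, j) \<notin> ?D \<longrightarrow> X $ i $ j = 0}"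
  let ?f = "\<lambda>X :: real^'n^'n. X - transpose X"
  have lin: "linear ?f"
    by (intro linearI) (simp_all add: transpose_add transpose_scalar algebra_simps)
  have T: "subspace ?T" by (auto simp: subspace_def)
  have "X = 0" if T: "X \<in> ?T" and "?f X = 0" for X
  proof -
    have "X $ i $ j = 0" for i j
    proof (cases "(i, j) \<in> ?D")
      \<comment> \<open>The mirrored entry lies outside \<open>?D\<close> and vanishes, so
        \<open>?f X\<close> keeps the entry of \<open>X\<close> at this position.\<close>
      case True
      then have "(j, i) \<notin> ?D" by auto
      then have "X $ j $ i = 0" using T by blast
      moreover have "?f X $ i $ j = 0" unfolding \<open>?f X = 0\<close> by simp
      ultimately show ?thesis by (simp add: transpose_def)
    qed (use T in blast)
    then show ?thesis by (simp add: vec_eq_iff)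
  qed
  then have "inj_on ?f ?T"
    using linear_inj_on_iff_eq_0[OF lin T] by blast
  then have "dim (?f ` ?T) = dim ?T"
    using lin T by (intro dim_image_eq) (simp_all add: span_eq_iff[THEN iffD2])
  moreover have "?f ` ?T = skew_matrices"
  proof
    show "?f ` ?T \<subseteq> skew_matrices" by (auto simp: skew_matrices_def transpose_diff)
    show "skew_matrices \<subseteq> ?f ` ?T"
    proof
      fix Y :: "real^'n^'n" assume "Y \<in> skew_matrices"
      then have Y: "Y $ j $ i = - Y $ i $ j" for i j
      proof -
        assume "Y \<in> skew_matrices"
        then have "transpose Y $ i $ j = (- Y) $ i $ j"
          by (simp only: skew_matrices_def mem_Collect_eq)
        then show ?thesis by (simp add: transpose_def)
      qed
      \<comment> \<open>The preimage of \<open>Y\<close> is its strictly upper triangular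
        part.\<close>
      define X where "X = (\<chi> i j. if (i, j) \<in> ?D then Y $ i $ j else 0)"
      have "Y $ i $ j = ?f X $ i $ j" for i j
      proof (cases "i = j")
        case True
        then have "Y $ i $ j = 0" using Y[of i j] by (metis equal_neg_zero)
        with True show ?thesis by (simp add: X_def transpose_def)
      next
        case False
        then have "to_nat i \<noteq> to_nat j" by simp
        then show ?thesis
          using Y[of j i] by (auto simp: X_def transpose_def)
      qed
      then have "Y = ?f X" by (simp add: vec_eq_iff)
      moreover have "X \<in> ?T" by (simp add: X_def)
      ultimately show "Y \<in> ?f ` ?T" by blast
    qed
  qed
  ultimately show ?thesis
    using dim_matrices_supported_on[of ?D] card_strictly_ordered_pairs[OF inj_to_nat, where 'n = 'n]
    by simp
qed

section \<open>Indices of a form from complementary definite subspaces\<close>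

text \<open>A subspace on which a form is positive definite meets any negative definite subspace
  trivially, so complementary definite subspaces realise both indices.\<close>

lemma positive_index_eq_dim:
  fixes b :: "'a::euclidean_space \<Rightarrow> 'a \<Rightarrow> real"
  assumes "subspace P" "\<And>v. v \<in> P - {0} \<Longrightarrow> b v v > 0"
    and "subspace N" "\<And>v. v \<in> N - {0} \<Longrightarrow> b v v \<le> 0"
    and "dim P + dim N = DIM('a)"
  shows "positive_index b = dim P"
  unfolding positive_index_def
proof (rule Max_eqI)
  have bound: "dim S \<le> dim P" if "subspace S" "\<forall>v\<in>S - {0}. b v v > 0" for S
  proof -
    have "v = 0" if "v \<in> S" "v \<in> N" for v
      using \<open>\<forall>v\<in>S - {0}. b v v > 0\<close> assms(4)[of v] that
      by (meson DiffI empty_iff insert_iff not_less)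
    then have "S \<inter> N \<subseteq> {0}" by blast
    then have "dim (S \<inter> N) = 0" by simp
    \<comment> \<open>With trivial intersection, \<open>dim S + dim N\<close> is at most the ambient
      dimension, which is \<open>dim P + dim N\<close>.\<close>
    then have "dim {x + y |x y. x \<in> S \<and> y \<in> N} = dim S + dim N"
      using dim_sums_Int[OF that(1) assms(3)] by linarith
    moreover have "dim {x + y |x y. x \<in> S \<and> y \<in> N} \<le> DIM('a)"
      by (rule dim_subset_UNIV)
    ultimately show ?thesis using assms(5) by linarith
  qed
  show "finite {dim S |S. subspace S \<and> (\<forall>v\<in>S - {0}. b v v > 0)}"
    by (rule finite_subset[OF _ finite_atMost[of "dim P"]]) (use bound in blast)
  show "n \<le> dim P" if "n \<in> {dim S |S. subspace S \<and> (\<forall>v\<in>S - {0}. b v v > 0)}" for n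
    using that bound by blast
  show "dim P \<in> {dim S |S. subspace S \<and> (\<forall>v\<in>S - {0}. b v v > 0)}"
    using assms(1,2) by blast
qed

lemma negative_index_conv_positive: "negative_index b = positive_index (\<lambda>v w. - b v w)"
  by (simp add: negative_index_def positive_index_def)

text \<open>The negative index is the positive index of the negated form, for which \<open>P\<close>
  and \<open>N\<close> exchange roles.\<close>

lemma signature_eq_dims:
  fixes b :: "'a::euclidean_space \<Rightarrow> 'a \<Rightarrow> real"
  assumes "subspace P" "\<And>v. v \<in> P - {0} \<Longrightarrow> b v v > 0"
    and "subspace N" "\<And>v. v \<in> N - {0} \<Longrightarrow> b v v < 0"
    and "dim P + dim N = DIM('a)"
  shows "signature b = (dim P, dim N)"
proof -
  have "positive_index b = dim P"
    by (rule positive_index_eq_dim[OF assms(1,2,3) less_imp_le[OF assms(4)] assms(5)])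
  moreover have "positive_index (\<lambda>v w. - b v w) = dim N"
  proof (rule positive_index_eq_dim[OF assms(3) _ assms(1)])
    show "- b v v > 0" if "v \<in> N - {0}" for v using assms(4)[OF that] by simp
    show "- b v v \<le> 0" if "v \<in> P - {0}" for v using assms(2)[OF that] by simp
    show "dim N + dim P = DIM('a)" using assms(5) by simp
  qed
  ultimately show ?thesis by (simp add: signature_def negative_index_conv_positive)
qed

text \<open>This identifies the Frobenius product with the Euclidean inner product, the source of
  definiteness and of nondegeneracy below.\<close>

lemma trace_mult_transpose: "trace (X ** transpose X) = X \<bullet> (X :: real^'n^'n)"
  by (simp add: trace_def matrix_matrix_mult_def transpose_def inner_vec_def)

lemma signature_trace_metric:
  fixes A :: "real^'n^'n"
  assumes A: "A \<in> general_linear"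
  shows "signature (trace_metric A)
    = (CARD('n) * (CARD('n) + 1) div 2, CARD('n) * (CARD('n) - 1) div 2)"
proof -
  let ?S = "symmetric_matrices :: (real^'n^'n) set" and ?K = "skew_matrices :: (real^'n^'n) set"
  have lin: "linear ((**) A :: real^'n^'n \<Rightarrow> real^'n^'n)"
    using bounded_bilinear_matrix_mult bilinear_conv_bounded_bilinear bilinear_def by blast
  have inj: "inj ((**) A :: real^'n^'n \<Rightarrow> real^'n^'n)"
    using matrix_inv_cancel(2)[OF A] by (rule inj_on_inverseI)
  have dim: "dim ((**) A ` T) = dim T" for T :: "(real^'n^'n) set"
    using lin inj by (intro dim_image_eq) (auto intro: inj_on_subset)
  have metric: "trace_metric A (A ** X) (A ** Y) = trace (X ** Y)" for X Y :: "real^'n^'n"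
    by (simp add: trace_metric_def matrix_mul_assoc matrix_inv_cancel matrix_inv_mult A)
  have skew: "2 * dim ?K = CARD('n) * (CARD('n) - 1)" by (rule dim_skew_matrices)
  have sum: "dim ?S + dim ?K = CARD('n) * CARD('n)" by (rule dim_symmetric_plus_skew)
  have "2 * dim ?S = CARD('n) * (CARD('n) + 1)"
  proof -
    \<comment> \<open>Subtraction on naturals truncates, hence the case split.\<close>
    have "CARD('n) * (CARD('n) + 1) + CARD('n) * (CARD('n) - 1) = 2 * (CARD('n) * CARD('n))"
      by (cases "CARD('n)") (auto simp: algebra_simps)
    with skew sum show ?thesis by linarith
  qed
  moreover have "signature (trace_metric A) = (dim ((**) A ` ?S), dim ((**) A ` ?K))"
  proof (rule signature_eq_dims)
    show "0 < trace_metric A V V" if V: "V \<in> (**) A ` ?S - {0}" for V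
    proof -
      obtain X where "V = A ** X" "transpose X = X"
        using V by (auto simp: symmetric_matrices_def)
      with V show ?thesis
        using trace_mult_transpose[of X] by (auto simp: metric)
    qed
    show "trace_metric A V V < 0" if V: "V \<in> (**) A ` ?K - {0}" for V
    proof -
      obtain X where AX: "V = A ** X" and X: "transpose X = - X"
        using V by (auto simp: skew_matrices_def)
      \<comment> \<open>Replacing \<open>transpose X\<close> by \<open>- X\<close> in the Frobenius
        product brings in the minus sign.\<close>
      have "trace (X ** X) = - (X \<bullet> X)"
        using trace_mult_transpose[of X] unfolding X
        by (simp add: bounded_bilinear.minus_right[OF bounded_bilinear_matrix_mult]
            linear_neg[OF linear_trace])
      then show ?thesis using V by (auto simp: metric AX)
    qed
    show "dim ((**) A ` ?S) + dim ((**) A ` ?K) = DIM(real^'n^'n)"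
      using sum by (simp add: dim)
  qed (intro linear_subspace_image lin subspace_symmetric_matrices subspace_skew_matrices)+
  ultimately show ?thesis
    \<comment> \<open>Both products equal twice a dimension, so \<open>div 2\<close> is
      exact.\<close>
    unfolding dim skew[symmetric] by (metis nonzero_mult_div_cancel_left zero_neq_numeral)
qed

text \<open>With \<open>X\<close> the product \<open>matrix_inv A ** V ** matrix_inv A\<close>, the
  value on \<open>W\<close> is \<open>trace (X ** W)\<close>; the test vector
  \<open>transpose X\<close> makes it the squared norm of \<open>X\<close>.\<close>

lemma nondegenerate_trace_metric:
  fixes A :: "real^'n^'n"
  assumes A: "A \<in> general_linear"
  shows "nondegenerate_form (trace_metric A)"
  unfolding nondegenerate_form_def
proof (intro allI impI)
  fix V :: "real^'n^'n"
  assume V: "\<forall>W. trace_metric A V W = 0"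
  define X where "X = matrix_inv A ** V ** matrix_inv A"
  have "X \<bullet> X = 0"
    using V trace_mult_transpose[of X] by (simp add: trace_metric_def X_def)
  then have "A ** X ** A = 0" by simp
  then show "V = 0" by (simp add: X_def matrix_mul_assoc matrix_inv_cancel matrix_inv_mult A)
qed

theorem proposition1p1:
  shows "semi_riemannian_manifold (general_linear :: (real^'n^'n) set) trace_metric \<and>
    homogeneous (general_linear :: (real^'n^'n) set) trace_metric \<and>
    (\<forall>A \<in> (general_linear :: (real^'n^'n) set).
       signature (trace_metric A)
         = (CARD('n) * (CARD('n) + 1) div 2, CARD('n) * (CARD('n) - 1) div 2))"
  unfolding semi_riemannian_manifold_def
  using open_general_linear smooth_tensor_field_trace_metric symmetric_trace_metric
    nondegenerate_trace_metric homogeneous_trace_metric signature_trace_metric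
  by blast

end
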